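(* Let $\mathcal H$ be a separable Hilbert space, $J$ a countable index set, $I=\{1,\dots,m\}$. Let the family of frames $\{F_i=\{f_{ij}\}_{j\in J}\}_{i\in I}$ be woven with universal bounds $A,B$, and for each $i\in I$ let $F_i'=\{f_{ij}'\}_{j\in J}$ be a $\lambda_i$-perturbation of $F_i$. If $\lambda_i<\dfrac{A}{2\sqrt{mB}}$ for all $i\in I$, then the family of frames $\{F_i'\}_{i\in I}$ is woven in $\mathcal H$.
   Context: A sequence $\{f_j\}_{j\in J}$ in $\mathcal H$ is a frame for $\mathcal H$ with lower and upper bounds $A,B>0$ if $A\|f\|^2\le\sum_{j\in J}|\langle f,f_j\rangle|^2\le B\|f\|^2$ for all $f\in\mathcal H$. For sequences $F=\{f_j\}_{j\in J}$, $G=\{g_j\}_{j\in J}$ in $\mathcal H$ and $0<\lambda<1$, $G$ is a $\lambda$-perturbation of $F$ if for every sequence $\{c_j\}_{j\in J}$ of positive numbers with $\sum_{j\in J}c_j^2<\infty$ one has $\big\|\sum_{j\in J}c_j(f_j-g_j)\big\|\le\lambda\|\{c_j\}_{j\in J}\|$, where $\|\{c_j\}\|=(\sum_j c_j^2)^{1/2}$. A partition $\{\sigma_i\}_{i\in I}$ of $J$ is a family of pairwise disjoint (possibly empty) subsets of $J$ with union $J$. A family of frames $\{F_i=\{f_{ij}\}_{j\in J}\}_{i\in I}$ is woven with universal bounds $A,B>0$ if for every partition $\{\sigma_i\}_{i\in I}$ of $J$ the family $\{f_{ij}\}_{j\in\sigma_i,i\in I}$ is a frame for $\mathcal H$ with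 bounds $A$ and $B$; it is woven if such universal bounds exist. *)

theory Defs
  imports "HOL-Analysis.Analysis"
begin

text \<open>
  Scalar fields: the reals and the complex numbers. By the Gelfand--Mazur theorem a real normed
  field is isomorphic to one of these two, and the axiom \<open>mult_conj\<close> then determines the
  conjugation, so the class admits no other models.
\<close>

class rc_field = real_normed_field +
  fixes conj :: "'a \<Rightarrow> 'a"
  assumes conj_add: "conj (x + y) = conj x + conj y"
    and conj_mult: "conj (x * y) = conj x * conj y"
    and conj_conj: "conj (conj x) = x"
    and mult_conj: "x * conj x = ((norm x)\<^sup>2) *\<^sub>R 1"

instantiation real :: rc_field
begin

definition conj_real :: "real \<Rightarrow> real" where
  "conj_real x = x"

instance
  by standard (simp_all add: conj_real_def power2_eq_square)

end

instantiation complex :: rc_field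
begin

definition conj_complex :: "complex \<Rightarrow> complex" where
  "conj_complex = cnj"

instance
  by standard (simp_all add: conj_complex_def complex_norm_square[symmetric] scaleR_conv_of_real)

end

text \<open>
  Completeness is part of the class \<open>banach\<close>. The inner product is linear in its first argument
  and induces the norm; \<open>scale_of_real\<close> says that the scalar multiplication extends the real
  scalar multiplication of the type.
\<close>

locale hilbert_space = vector_space scale
  for scale :: "'k::rc_field \<Rightarrow> 'h::banach \<Rightarrow> 'h" +
  fixes ip :: "'h \<Rightarrow> 'h \<Rightarrow> 'k"
  assumes scale_of_real: "scale (of_real r) x = r *\<^sub>R x"
    and ip_add_left: "ip (x + y) z = ip x z + ip y z"
    and ip_scale_left: "ip (scale c x) y = c * ip x y"
    and ip_conj: "ip y x = conj (ip x y)"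
    and ip_norm: "ip x x = of_real ((norm x)\<^sup>2)"

lemma hilbert_space_real:
  "hilbert_space (*\<^sub>R) (inner :: 'a::{real_inner,banach} \<Rightarrow> 'a \<Rightarrow> real)"
  by unfold_locales
    (auto simp: algebra_simps inner_commute conj_real_def power2_norm_eq_inner)

lemma hilbert_space_complex:
  "hilbert_space (*) (\<lambda>x y :: complex. x * cnj y)"
  by unfold_locales
    (auto simp: algebra_simps conj_complex_def complex_norm_square[symmetric] scaleR_conv_of_real)

text \<open>
  Unconditional sums are used throughout. Summability is required explicitly, because
  \<open>infsum\<close> is \<open>0\<close> for families that are not summable.
\<close>

definition frame_with ::
    "('h::real_normed_vector \<Rightarrow> 'h \<Rightarrow> 'k::rc_field) \<Rightarrow> 'i set \<Rightarrow> ('i \<Rightarrow> 'h) \<Rightarrow> real \<Rightarrow> real \<Rightarrow> bool"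
  where "frame_with ip K e A B \<longleftrightarrow> 0 < A \<and> 0 < B \<and>
    (\<forall>f. (\<lambda>k. (norm (ip f (e k)))\<^sup>2) summable_on K \<and>
         A * (norm f)\<^sup>2 \<le> (\<Sum>\<^sub>\<infinity>k\<in>K. (norm (ip f (e k)))\<^sup>2) \<and>
         (\<Sum>\<^sub>\<infinity>k\<in>K. (norm (ip f (e k)))\<^sup>2) \<le> B * (norm f)\<^sup>2)"

definition is_frame ::
    "('h::real_normed_vector \<Rightarrow> 'h \<Rightarrow> 'k::rc_field) \<Rightarrow> 'i set \<Rightarrow> ('i \<Rightarrow> 'h) \<Rightarrow> bool"
  where "is_frame ip K e \<longleftrightarrow> (\<exists>A B. frame_with ip K e A B)"

definition perturbation ::
    "'j set \<Rightarrow> real \<Rightarrow> ('j \<Rightarrow> 'h::real_normed_vector) \<Rightarrow> ('j \<Rightarrow> 'h) \<Rightarrow> bool"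
  where "perturbation J l F G \<longleftrightarrow> 0 < l \<and> l < 1 \<and>
    (\<forall>c :: 'j \<Rightarrow> real. (\<forall>j\<in>J. 0 < c j) \<and> (\<lambda>j. (c j)\<^sup>2) summable_on J \<longrightarrow>
       (\<lambda>j. c j *\<^sub>R (F j - G j)) summable_on J \<and>
       norm (\<Sum>\<^sub>\<infinity>j\<in>J. c j *\<^sub>R (F j - G j)) \<le> l * sqrt (\<Sum>\<^sub>\<infinity>j\<in>J. (c j)\<^sup>2))"

text \<open>
  Blocks may be empty, which \<open>partition_on\<close> does not allow; a partition is therefore an
  indexed family.
\<close>

definition indexed_partition :: "'i set \<Rightarrow> 'j set \<Rightarrow> ('i \<Rightarrow> 'j set) \<Rightarrow> bool"
  where "indexed_partition I J \<sigma> \<longleftrightarrow> disjoint_family_on \<sigma> I \<and> (\<Union>i\<in>I. \<sigma> i) = J"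

definition woven_with ::
    "('h::real_normed_vector \<Rightarrow> 'h \<Rightarrow> 'k::rc_field) \<Rightarrow> 'i set \<Rightarrow> 'j set \<Rightarrow> ('i \<Rightarrow> 'j \<Rightarrow> 'h) \<Rightarrow>
      real \<Rightarrow> real \<Rightarrow> bool"
  where "woven_with ip I J F A B \<longleftrightarrow> 0 < A \<and> 0 < B \<and>
    (\<forall>i\<in>I. is_frame ip J (F i)) \<and>
    (\<forall>\<sigma>. indexed_partition I J \<sigma> \<longrightarrow>
       frame_with ip (SIGMA i:I. \<sigma> i) (\<lambda>(i, j). F i j) A B)"

definition woven ::
    "('h::real_normed_vector \<Rightarrow> 'h \<Rightarrow> 'k::rc_field) \<Rightarrow> 'i set \<Rightarrow> 'j set \<Rightarrow> ('i \<Rightarrow> 'j \<Rightarrow> 'h) \<Rightarrow> bool"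
  where "woven ip I J F \<longleftrightarrow> (\<exists>A B. woven_with ip I J F A B)"

end

theory Submission
  imports Defs
begin

text \<open>
  Fix \<open>f\<close> and a finite \<open>S \<subseteq> J\<close>, and let \<open>D\<close> be the sequence of differences of a
  \<open>l\<close>-perturbation. By a limit argument the perturbation inequality also holds for nonnegative
  coefficients supported on \<open>S\<close>. Pairing with \<open>f\<close> and taking the positive parts of
  \<open>Re \<langle>f, D j\<rangle>\<close> as coefficients bounds the sum of their squares by \<open>(l * norm f)\<^sup>2\<close>. Doing this
  for \<open>f\<close>, \<open>- f\<close>, \<open>\<i> f\<close> and \<open>- \<i> f\<close> shows that the sum of \<open>\<bar>\<langle>f, D j\<rangle>\<bar>\<^sup>2\<close> is at most
  \<open>4 l\<^sup>2 (norm f)\<^sup>2\<close>. Hence the differences along any partition have Bessel bound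
  \<open>4 (\<Sum>i. (lam i)\<^sup>2) < A\<^sup>2 / B \<le> A\<close>, and the triangle inequality in \<open>\<ell>\<^sup>2\<close> turns the frame bounds of
  the \<open>F i\<close> into frame bounds of the \<open>F' i\<close>.
\<close>

section \<open>Scalars\<close>

lemma conj_zero: "conj (0::'k::rc_field) = 0"
  using conj_add[of "0::'k" 0] by simp

text \<open>For nonzero \<open>r\<close>, \<open>mult_conj\<close> gives
  \<open>r * conj r = r * r\<close>, and \<open>r\<close> cancels.\<close>

lemma conj_of_real: "conj (of_real r :: 'k::rc_field) = of_real r"
proof (cases "r = 0")
  case False
  have "of_real r * conj (of_real r :: 'k) = of_real r * of_real r"
    by (simp add: mult_conj scaleR_conv_of_real power2_eq_square flip: of_real_mult)
  then show ?thesis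
    using False by simp
qed (simp add: conj_zero)

lemma conj_minus: "conj (- x) = - conj (x::'k::rc_field)"
  using conj_add[of x "- x"] by (simp add: conj_zero eq_neg_iff_add_eq_0 add.commute)

lemma conj_diff: "conj (x - y) = conj x - conj (y::'k::rc_field)"
  using conj_add[of x "- y"] by (simp add: conj_minus)

lemma mult_conj_of_real: "x * conj x = of_real ((norm x)\<^sup>2)" for x :: "'k::rc_field"
  by (simp add: mult_conj scaleR_conv_of_real)

text \<open>The real part, read off from \<open>\<bar>x + 1\<bar>\<^sup>2 = \<bar>x\<bar>\<^sup>2 + 2 Re x + 1\<close>.\<close>

definition re_part :: "'k::rc_field \<Rightarrow> real" where
  "re_part x = ((norm (x + 1))\<^sup>2 - (norm x)\<^sup>2 - 1) / 2"

lemma of_real_re_part: "of_real (2 * re_part x) = x + conj (x::'k::rc_field)"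
proof -
  have "conj (1::'k) = 1"
    using conj_of_real[of 1] by simp
  then have "(x + 1) * conj (x + 1) = x * conj x + (x + conj x) + 1"
    by (simp add: conj_add algebra_simps)
  then have "of_real ((norm (x + 1))\<^sup>2) = of_real ((norm x)\<^sup>2) + (x + conj x) + 1"
    by (simp only: mult_conj_of_real)
  then show ?thesis
    by (simp add: re_part_def)
qed

text \<open>This trades the norm formula for the equation \<open>x + conj x = 2 * r\<close>, which
  is additive and real-homogeneous in \<open>x\<close>; the rules below follow from it.\<close>

lemma re_part_unique:
  fixes x :: "'k::rc_field"
  assumes "x + conj x = of_real (2 * r)"
  shows "re_part x = r"
proof -
  have "(of_real (2 * re_part x) :: 'k) = of_real (2 * r)"
    using assms of_real_re_part[of x] by simp
  then show ?thesis
    by (simp only: of_real_eq_iff)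
qed

lemma re_part_add: "re_part (x + y) = re_part x + re_part (y::'k::rc_field)"
proof (rule re_part_unique)
  show "x + y + conj (x + y) = of_real (2 * (re_part x + re_part y))"
    using of_real_re_part[of x] of_real_re_part[of y]
    by (simp add: conj_add distrib_left algebra_simps)
qed

lemma re_part_of_real_mult: "re_part (of_real r * x) = r * re_part (x::'k::rc_field)"
proof (rule re_part_unique)
  have "of_real r * x + conj (of_real r * x) = of_real r * (x + conj x)"
    by (simp add: conj_mult conj_of_real algebra_simps)
  also have "\<dots> = of_real (2 * (r * re_part x))"
    by (simp flip: of_real_re_part)
  finally show "of_real r * x + conj (of_real r * x) = of_real (2 * (r * re_part x))" .
qed

lemma re_part_of_real: "re_part (of_real r :: 'k::rc_field) = r"
  by (rule re_part_unique) (simp add: conj_of_real)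

lemma re_part_conj: "re_part (conj x) = re_part (x::'k::rc_field)"
  using of_real_re_part[of x] by (intro re_part_unique) (simp add: conj_conj add.commute)

text \<open>
  Up to sign, the witness is the imaginary unit; if the conjugation is trivial, so that there is
  none, it is \<open>1\<close>.
\<close>

lemma norm_le_re_parts:
  obtains u :: "'k::rc_field" where "norm u = 1"
    and "\<And>x. (norm x)\<^sup>2 \<le> (re_part x)\<^sup>2 + (re_part (u * x))\<^sup>2"
proof (cases "\<forall>x::'k. conj x = x")
  case True
  have "(norm x)\<^sup>2 \<le> (re_part x)\<^sup>2 + (re_part (1 * x))\<^sup>2" for x :: 'k
  proof -
    have "of_real (2 * re_part x) = 2 * x"
      using True by (simp add: of_real_re_part del: of_real_mult)
    then have "x = of_real (re_part x)"
      by simp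
    then have "norm x = \<bar>re_part x\<bar>"
      by (metis norm_of_real)
    then show ?thesis
      by simp
  qed
  then show thesis
    using that[of 1] by simp
next
  case False
  then obtain z :: 'k where z: "conj z \<noteq> z"
    by blast
  \<comment> \<open>Conjugation negates \<open>y\<close>, so \<open>y\<close> is purely imaginary;
    scaled to norm 1 it squares to -1.\<close>
  define y where "y = z - conj z"
  define u where "u = of_real (inverse (norm y)) * y"
  have "y \<noteq> 0"
    using z by (simp add: y_def)
  then have u1: "norm u = 1"
    by (simp add: u_def norm_mult norm_inverse)
  have cu: "conj u = - u"
    unfolding u_def y_def conj_mult conj_of_real conj_diff conj_conj
    by (simp add: algebra_simps)
  have uu: "u * u = -1"
    using mult_conj_of_real[of u] by (simp add: cu u1 minus_equation_iff[of "u * u"])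
  have "(norm x)\<^sup>2 = (re_part x)\<^sup>2 + (re_part (u * x))\<^sup>2" for x :: 'k
  proof -
    \<comment> \<open>Up to sign, \<open>re_part (u * x)\<close> is the imaginary part of
      \<open>x\<close>; as \<open>u * u = -1\<close>, the claim reduces to
      \<open>(x + conj x)^2 - (x - conj x)^2 = 4 * (x * conj x)\<close>.\<close>
    have b: "of_real (2 * re_part (u * x)) = u * (x - conj x)"
      by (simp only: of_real_re_part conj_mult cu) (simp add: algebra_simps)
    have "(of_real ((2 * re_part x)\<^sup>2 + (2 * re_part (u * x))\<^sup>2) :: 'k)
        = (x + conj x)\<^sup>2 + (u * (x - conj x))\<^sup>2"
      unfolding of_real_add of_real_power b of_real_re_part[of x] ..
    also have "\<dots> = (x + conj x)\<^sup>2 + (u * u) * (x - conj x)\<^sup>2"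
      by (simp add: power2_eq_square algebra_simps)
    also have "\<dots> = 4 * (x * conj x)"
      by (simp add: uu power2_eq_square algebra_simps)
    also have "\<dots> = of_real (4 * (norm x)\<^sup>2)"
      by (simp add: mult_conj_of_real)
    finally show ?thesis
      by (simp only: of_real_eq_iff) (simp add: power_mult_distrib)
  qed
  then show thesis
    using that[of u] u1 by simp
qed

section \<open>Inner products\<close>

context hilbert_space
begin

lemma ip_zero_left: "ip 0 y = 0"
  using ip_add_left[of 0 0 y] by simp

lemma ip_add_right: "ip x (y + z) = ip x y + ip x z"
  by (metis ip_conj ip_add_left conj_add)

lemma ip_diff_right: "ip x (y - z) = ip x y - ip x z"
  using ip_add_right[of x "y - z" z] by simp

lemma ip_zero_right: "ip x 0 = 0"
  using ip_diff_right[of x 0 0] by simp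

lemma ip_scaleR_left: "ip (r *\<^sub>R x) y = of_real r * ip x y"
  by (metis ip_scale_left scale_of_real)

lemma ip_scaleR_right: "ip x (r *\<^sub>R y) = of_real r * ip x y"
  by (metis ip_conj ip_scaleR_left conj_mult conj_of_real)

lemma ip_minus_left: "ip (- x) y = - ip x y"
  using ip_scaleR_left[of "-1" x y] by simp

lemma ip_sum_right: "ip x (sum g S) = (\<Sum>s\<in>S. ip x (g s))"
  by (induction S rule: infinite_finite_induct) (simp_all add: ip_zero_right ip_add_right)

text \<open>The class \<open>banach\<close> gives homogeneity for real scalars only; for general
  ones it is read off from the inner product.\<close>

lemma norm_scale: "norm (scale u x) = norm u * norm x"
proof -
  have "(of_real ((norm (scale u x))\<^sup>2) ::'k) = ip (scale u x) (scale u x)"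
    by (simp only: ip_norm)
  also have "\<dots> = (u * conj u) * ip x x"
    using ip_conj[of x "scale u x"] ip_conj[of x x]
    by (simp add: ip_scale_left conj_mult algebra_simps)
  also have "\<dots> = of_real ((norm u * norm x)\<^sup>2)"
    by (simp add: mult_conj_of_real ip_norm power_mult_distrib)
  finally show ?thesis
    by (simp only: of_real_eq_iff) (simp add: power2_eq_iff_nonneg)
qed

text \<open>The Cauchy--Schwarz inequality is equivalent to the triangle inequality, which is given.\<close>

lemma re_part_ip_le: "re_part (ip x y) \<le> norm x * norm y"
proof -
  have "re_part (ip (x + y) (x + y))
      = re_part (ip x x) + 2 * re_part (ip x y) + re_part (ip y y)"
    using ip_conj[of y x] by (simp add: ip_add_left ip_add_right re_part_add re_part_conj)
  then have "(norm (x + y))\<^sup>2 = (norm x)\<^sup>2 + 2 * re_part (ip x y) + (norm y)\<^sup>2"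
    by (simp only: ip_norm re_part_of_real)
  moreover have "(norm (x + y))\<^sup>2 \<le> (norm x + norm y)\<^sup>2"
    by (intro power_mono norm_triangle_ineq) simp
  ultimately show ?thesis
    by (simp add: power2_sum)
qed

section \<open>Bessel bounds of perturbations\<close>

lemma sum_positive_part_le:
  assumes "finite S"
    and D: "\<And>a. (\<And>j. 0 \<le> a j) \<Longrightarrow> norm (\<Sum>j\<in>S. a j *\<^sub>R D j) \<le> l * sqrt (\<Sum>j\<in>S. (a j)\<^sup>2)"
  shows "(\<Sum>j\<in>S. (max 0 (re_part (ip f (D j))))\<^sup>2) \<le> (l * norm f)\<^sup>2"
proof -
  define a where "a j = max 0 (re_part (ip f (D j)))" for j
  define s where "s = sqrt (\<Sum>j\<in>S. (a j)\<^sup>2)"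
  have s2: "s\<^sup>2 = (\<Sum>j\<in>S. (a j)\<^sup>2)"
    by (simp add: s_def sum_nonneg)
  have s0: "0 \<le> s"
    by (simp add: s_def sum_nonneg)
  have re_sum: "re_part (\<Sum>j\<in>S. x j) = (\<Sum>j\<in>S. re_part (x j))" for x :: "_ \<Rightarrow> 'k"
    using \<open>finite S\<close>
    by induction (use re_part_of_real[of 0, where 'k='k] in \<open>simp_all add: re_part_add\<close>)
  \<comment> \<open>Where the real part is negative, \<open>a j = 0\<close> and both terms
    vanish.\<close>
  have "s * s = (\<Sum>j\<in>S. a j * re_part (ip f (D j)))"
    unfolding s2[unfolded power2_eq_square] by (rule sum.cong) (auto simp: a_def max_def)
  also have "\<dots> = re_part (ip f (\<Sum>j\<in>S. a j *\<^sub>R D j))"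
    by (simp add: ip_sum_right ip_scaleR_right re_sum re_part_of_real_mult)
  also have "\<dots> \<le> norm f * norm (\<Sum>j\<in>S. a j *\<^sub>R D j)"
    by (rule re_part_ip_le)
  also have "\<dots> \<le> norm f * (l * s)"
    unfolding s_def by (intro mult_left_mono D) (simp_all add: a_def)
  finally have "s * s \<le> (l * norm f) * s"
    by (simp add: algebra_simps)
  then have "s \<le> l * norm f \<or> s = 0"
    using s0 by (auto simp: mult_le_cancel_right)
  then have "s\<^sup>2 \<le> (l * norm f)\<^sup>2"
    using s0 by (auto intro: power_mono)
  then show ?thesis
    by (simp add: s2 a_def)
qed

text \<open>The constant 4 is a factor 2 for the two signs of a real part times a factor 2 for the
  real and imaginary parts.\<close>

lemma sum_ip_le:
  assumes "finite S"
    and D: "\<And>a. (\<And>j. 0 \<le> a j) \<Longrightarrow> norm (\<Sum>j\<in>S. a j *\<^sub>R D j) \<le> l * sqrt (\<Sum>j\<in>S. (a j)\<^sup>2)"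
  shows "(\<Sum>j\<in>S. (norm (ip f (D j)))\<^sup>2) \<le> 4 * l\<^sup>2 * (norm f)\<^sup>2"
proof -
  obtain u ::'k where u: "norm u = 1"
    and re: "\<And>x. (norm x)\<^sup>2 \<le> (re_part x)\<^sup>2 + (re_part (u * x))\<^sup>2"
    using norm_le_re_parts by blast
  have half: "(\<Sum>j\<in>S. (re_part (ip g (D j)))\<^sup>2) \<le> 2 * (l * norm g)\<^sup>2" for g
  proof -
    have neg: "re_part (ip (- g) (D j)) = - re_part (ip g (D j))" for j
      using re_part_of_real_mult[of "-1"] by (simp add: ip_minus_left)
    \<comment> \<open>The negative part for \<open>g\<close> is the positive part for
      \<open>- g\<close>.\<close>
    have "(\<Sum>j\<in>S. (re_part (ip g (D j)))\<^sup>2) = (\<Sum>j\<in>S. (max 0 (re_part (ip g (D j))))\<^sup>2)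
        + (\<Sum>j\<in>S. (max 0 (re_part (ip (- g) (D j))))\<^sup>2)"
      unfolding sum.distrib[symmetric] neg by (rule sum.cong) (auto simp: max_def)
    then show ?thesis
      using sum_positive_part_le[OF assms, of g] sum_positive_part_le[OF assms, of "- g"]
      by simp
  qed
  have "(\<Sum>j\<in>S. (norm (ip f (D j)))\<^sup>2)
      \<le> (\<Sum>j\<in>S. (re_part (ip f (D j)))\<^sup>2) + (\<Sum>j\<in>S. (re_part (ip (scale u f) (D j)))\<^sup>2)"
    unfolding sum.distrib[symmetric] ip_scale_left by (intro sum_mono re)
  also have "\<dots> \<le> 2 * (l * norm f)\<^sup>2 + 2 * (l * norm (scale u f))\<^sup>2"
    by (intro add_mono half)
  finally show ?thesis
    by (simp add: norm_scale u power_mult_distrib)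
qed

end

text \<open>Enumerating \<open>J\<close> injectively, the weights \<open>(1/2) ^ n\<close> have
  squares \<open>(1/4) ^ n\<close>, a geometric series.\<close>

lemma exists_positive_square_summable:
  assumes "countable J"
  obtains e :: "'j \<Rightarrow> real" where "\<And>j. 0 < e j" "(\<lambda>j. (e j)\<^sup>2) summable_on J"
proof -
  have "summable (\<lambda>n. norm ((1/4::real) ^ n))"
    by simp
  then have "(\<lambda>n. (1/4::real) ^ n) summable_on UNIV"
    by (rule norm_summable_imp_summable_on)
  then have "(\<lambda>n. (1/4::real) ^ n) summable_on to_nat_on J ` J"
    by (rule summable_on_subset_banach) simp
  then have "((\<lambda>n. (1/4::real) ^ n) \<circ> to_nat_on J) summable_on J"
    using assms by (subst (asm) summable_on_reindex) auto
  moreover have "((1/2::real) ^ n)\<^sup>2 = (1/4) ^ n" for n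
    by (simp add: power_divide power2_eq_square flip: power_mult_distrib)
  ultimately show thesis
    using that[of "\<lambda>j. (1/2) ^ to_nat_on J j"] by (simp add: o_def)
qed

lemma has_sum_finite_support:
  fixes g :: "'j \<Rightarrow> 'h::real_normed_vector"
  assumes "finite S" "S \<subseteq> J"
  shows "((\<lambda>j. if j \<in> S then g j else 0) has_sum sum g S) J"
proof -
  have "(g has_sum sum g S) S"
    using assms by (simp add: has_sum_finite)
  then show ?thesis
    using assms by (subst has_sum_cong_neutral[where T=S and g=g]) auto
qed

text \<open>
  Nonnegative coefficients supported on \<open>S\<close> are limits of the positive ones \<open>a + t * e\<close>
  as \<open>t\<close> tends to \<open>0\<close>.
\<close>

lemma perturbation_finite:
  fixes F G :: "'j \<Rightarrow> 'h::real_normed_vector"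
  assumes "perturbation J l F G" "countable J" "finite S" "S \<subseteq> J" "\<And>j. 0 \<le> a j"
  shows "norm (\<Sum>j\<in>S. a j *\<^sub>R (F j - G j)) \<le> l * sqrt (\<Sum>j\<in>S. (a j)\<^sup>2)"
proof -
  obtain e :: "'j \<Rightarrow> real" where e: "\<And>j. 0 < e j" and e2: "(\<lambda>j. (e j)\<^sup>2) summable_on J"
    using exists_positive_square_summable[OF \<open>countable J\<close>] by blast
  have pert: "(\<lambda>j. c j *\<^sub>R (F j - G j)) summable_on J"
    "norm (\<Sum>\<^sub>\<infinity>j\<in>J. c j *\<^sub>R (F j - G j)) \<le> l * sqrt (\<Sum>\<^sub>\<infinity>j\<in>J. (c j)\<^sup>2)"
    if "\<And>j. 0 < c j" "(\<lambda>j. (c j)\<^sup>2) summable_on J" for c :: "'j \<Rightarrow> real"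
    using assms(1) that by (auto simp: perturbation_def)
  \<comment> \<open>For coefficients \<open>a + t * e\<close>, the vector sum moves by
    \<open>t *\<^sub>R V\<close>, and the sum of squares gains the cross term \<open>t * X\<close>
    and \<open>t^2 * E\<close>.\<close>
  define V E X where "V = (\<Sum>\<^sub>\<infinity>j\<in>J. e j *\<^sub>R (F j - G j))"
    and "E = (\<Sum>\<^sub>\<infinity>j\<in>J. (e j)\<^sup>2)" and "X = (\<Sum>j\<in>S. 2 * a j * e j)"
  have V: "((\<lambda>j. e j *\<^sub>R (F j - G j)) has_sum V) J"
    unfolding V_def using e e2 by (intro has_sum_infsum pert(1))
  have E: "((\<lambda>j. (e j)\<^sup>2) has_sum E) J"
    unfolding E_def using e2 by (rule has_sum_infsum)
  let ?W = "\<Sum>j\<in>S. a j *\<^sub>R (F j - G j)" and ?Q = "\<Sum>j\<in>S. (a j)\<^sup>2"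
  have ineq: "norm (?W + t *\<^sub>R V) \<le> l * sqrt (?Q + t * X + t\<^sup>2 * E)" if "0 < t" for t
  proof -
    define c where "c j = (if j \<in> S then a j else 0) + t * e j" for j
    have pos: "0 < c j" for j
      using assms(5)[of j] e[of j] \<open>0 < t\<close> by (auto simp: c_def intro: add_nonneg_pos)
    have "((\<lambda>j. (if j \<in> S then (a j)\<^sup>2 + t * (2 * a j * e j) else 0) + t\<^sup>2 * (e j)\<^sup>2)
        has_sum ((\<Sum>j\<in>S. (a j)\<^sup>2 + t * (2 * a j * e j)) + t\<^sup>2 * E)) J"
      by (intro has_sum_add has_sum_finite_support has_sum_cmult_right E assms)
    moreover have "(\<lambda>j. (if j \<in> S then (a j)\<^sup>2 + t * (2 * a j * e j) else 0) + t\<^sup>2 * (e j)\<^sup>2)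
        = (\<lambda>j. (c j)\<^sup>2)"
      by (auto simp: c_def power2_sum power_mult_distrib)
    ultimately have c2: "((\<lambda>j. (c j)\<^sup>2) has_sum (?Q + t * X + t\<^sup>2 * E)) J"
      by (simp add: sum.distrib X_def sum_distrib_left)
    have "((\<lambda>j. (if j \<in> S then a j *\<^sub>R (F j - G j) else 0) + t *\<^sub>R (e j *\<^sub>R (F j - G j)))
        has_sum (?W + t *\<^sub>R V)) J"
      by (intro has_sum_add has_sum_finite_support has_sum_scaleR V assms)
    moreover have "(\<lambda>j. (if j \<in> S then a j *\<^sub>R (F j - G j) else 0) + t *\<^sub>R (e j *\<^sub>R (F j - G j)))
        = (\<lambda>j. c j *\<^sub>R (F j - G j))"
      by (auto simp: c_def scaleR_add_left)
    ultimately have "((\<lambda>j. c j *\<^sub>R (F j - G j)) has_sum (?W + t *\<^sub>R V)) J"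
      by simp
    then show ?thesis
      using pert(2)[of c] pos c2 by (simp add: infsumI has_sum_imp_summable)
  qed
  \<comment> \<open>The limit is one-sided because \<open>ineq\<close> needs \<open>t > 0\<close>,
    which keeps the coefficients positive off \<open>S\<close>.\<close>
  have "((\<lambda>t. norm (?W + t *\<^sub>R V)) \<longlongrightarrow> norm (?W + 0 *\<^sub>R V)) (at_right 0)"
    by (intro tendsto_intros)
  moreover have "((\<lambda>t. l * sqrt (?Q + t * X + t\<^sup>2 * E)) \<longlongrightarrow> l * sqrt (?Q + 0 * X + 0\<^sup>2 * E))
      (at_right 0)"
    by (intro tendsto_intros)
  moreover have "\<forall>\<^sub>F t in at_right 0. norm (?W + t *\<^sub>R V) \<le> l * sqrt (?Q + t * X + t\<^sup>2 * E)"
    using ineq by (auto simp: eventually_at_right_less intro: eventually_at_rightI[of 0 1])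
  ultimately show ?thesis
    using tendsto_le[OF trivial_limit_at_right_real] by fastforce
qed

section \<open>Frames and weaving\<close>

lemma frame_with_reindex:
  assumes "inj_on h K"
  shows "frame_with ip (h ` K) e A B \<longleftrightarrow> frame_with ip K (e \<circ> h) A B"
  unfolding frame_with_def summable_on_reindex[OF assms] infsum_reindex[OF assms]
  by (simp add: o_def)

lemma (in hilbert_space) frame_with_perturb:
  assumes fr: "frame_with ip K e A B" and "0 \<le> C" "C < A"
    and D: "\<And>f T. finite T \<Longrightarrow> T \<subseteq> K
      \<Longrightarrow> (\<Sum>k\<in>T. (norm (ip f (e k - e' k)))\<^sup>2) \<le> C * (norm f)\<^sup>2"
  shows "frame_with ip K e' ((sqrt A - sqrt C)\<^sup>2) ((sqrt B + sqrt C)\<^sup>2)"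
proof -
  have "0 < A" "0 < B"
    using fr by (auto simp: frame_with_def)
  have CA: "sqrt C < sqrt A"
    using \<open>C < A\<close> by simp
  have "(\<lambda>k. (norm (ip f (e' k)))\<^sup>2) summable_on K
      \<and> (sqrt A - sqrt C)\<^sup>2 * (norm f)\<^sup>2 \<le> (\<Sum>\<^sub>\<infinity>k\<in>K. (norm (ip f (e' k)))\<^sup>2)
      \<and> (\<Sum>\<^sub>\<infinity>k\<in>K. (norm (ip f (e' k)))\<^sup>2) \<le> (sqrt B + sqrt C)\<^sup>2 * (norm f)\<^sup>2" for f
  proof -
    define p p' where "p k = norm (ip f (e k))" and "p' k = norm (ip f (e' k))" for k
    define P P' where "P = (\<Sum>\<^sub>\<infinity>k\<in>K. (p k)\<^sup>2)" and "P' = (\<Sum>\<^sub>\<infinity>k\<in>K. (p' k)\<^sup>2)"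
    let ?n = "norm f"
    have sp: "(\<lambda>k. (p k)\<^sup>2) summable_on K" and lo: "A * ?n\<^sup>2 \<le> P" and hi: "P \<le> B * ?n\<^sup>2"
      using fr by (auto simp: frame_with_def p_def P_def)
    have dist: "L2_set p T \<le> L2_set p' T + sqrt C * ?n" "L2_set p' T \<le> L2_set p T + sqrt C * ?n"
      if T: "finite T" "T \<subseteq> K" for T
    proof -
      define d where "d k = norm (ip f (e k - e' k))" for k
      have "L2_set d T \<le> sqrt C * ?n"
        using D[OF T, of f] real_sqrt_le_mono by (fastforce simp: L2_set_def d_def real_sqrt_mult)
      moreover have "L2_set p T \<le> L2_set (\<lambda>k. p' k + d k) T"
        unfolding p_def p'_def d_def ip_diff_right
        by (intro L2_set_mono) (simp_all add: norm_triangle_sub)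
      moreover have "L2_set p' T \<le> L2_set (\<lambda>k. p k + d k) T"
        unfolding p_def p'_def d_def ip_diff_right
        by (intro L2_set_mono) (metis norm_triangle_sub norm_minus_commute, simp)
      ultimately show "L2_set p T \<le> L2_set p' T + sqrt C * ?n"
        "L2_set p' T \<le> L2_set p T + sqrt C * ?n"
        using L2_set_triangle_ineq[of p' d T] L2_set_triangle_ineq[of p d T] by linarith+
    qed
    have sq: "(\<Sum>k\<in>T. (q k)\<^sup>2) \<le> b\<^sup>2" if "L2_set q T \<le> b" for q b and T :: "'b set"
      using power_mono[OF that L2_set_nonneg, of 2] by (simp add: L2_set_def sum_nonneg)
    have bound': "(\<Sum>k\<in>T. (p' k)\<^sup>2) \<le> ((sqrt B + sqrt C) * ?n)\<^sup>2" if T: "finite T" "T \<subseteq> K" for T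
    proof (rule sq)
      have "(\<Sum>k\<in>T. (p k)\<^sup>2) \<le> P"
        unfolding P_def by (rule finite_sum_le_infsum[OF sp T]) simp
      then have "L2_set p T \<le> sqrt (B * ?n\<^sup>2)"
        unfolding L2_set_def using hi by (intro real_sqrt_le_mono) linarith
      then show "L2_set p' T \<le> (sqrt B + sqrt C) * ?n"
        using dist(2)[OF T] by (simp add: real_sqrt_mult algebra_simps)
    qed
    \<comment> \<open>The uniform bound on finite sums makes \<open>P'\<close> a genuine sum rather
      than the default 0, so the lower bound can be compared with it.\<close>
    have sp': "(\<lambda>k. (p' k)\<^sup>2) summable_on K"
      by (rule nonneg_bounded_partial_sums_imp_summable_on)
        (auto intro: eventually_finite_subsets_at_top_weakI bound')
    have hi': "P' \<le> ((sqrt B + sqrt C) * ?n)\<^sup>2"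
      unfolding P'_def by (rule infsum_le_finite_sums[OF sp' bound'])
    have "(\<Sum>k\<in>T. (p k)\<^sup>2) \<le> (sqrt P' + sqrt C * ?n)\<^sup>2" if T: "finite T" "T \<subseteq> K" for T
    proof (rule sq)
      have "(\<Sum>k\<in>T. (p' k)\<^sup>2) \<le> P'"
        unfolding P'_def by (rule finite_sum_le_infsum[OF sp' T]) simp
      then have "L2_set p' T \<le> sqrt P'"
        by (simp add: L2_set_def)
      then show "L2_set p T \<le> sqrt P' + sqrt C * ?n"
        using dist(1)[OF T] by linarith
    qed
    then have "P \<le> (sqrt P' + sqrt C * ?n)\<^sup>2"
      unfolding P_def by (rule infsum_le_finite_sums[OF sp])
    moreover have "0 \<le> P'"
      unfolding P'_def by (rule infsum_nonneg) simp
    ultimately have "sqrt (A * ?n\<^sup>2) \<le> sqrt P' + sqrt C * ?n"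
      using lo \<open>0 \<le> C\<close> by (intro real_le_lsqrt) auto
    then have "(sqrt A - sqrt C) * ?n \<le> sqrt P'"
      by (simp add: real_sqrt_mult algebra_simps)
    then have "((sqrt A - sqrt C) * ?n)\<^sup>2 \<le> (sqrt P')\<^sup>2"
      using CA by (intro power_mono) auto
    then show ?thesis
      using sp' hi' \<open>0 \<le> P'\<close> by (simp add: p'_def P'_def power_mult_distrib)
  qed
  moreover have "0 < sqrt B + sqrt C"
    using \<open>0 < B\<close> \<open>0 \<le> C\<close> by (simp add: add_pos_nonneg)
  ultimately show ?thesis
    using CA by (simp add: frame_with_def)
qed

text \<open>This partition isolates one family: it recovers the frame property of \<open>F i\<close>
  and yields \<open>A \<le> B\<close>.\<close>

lemma indexed_partition_single:
  assumes "i \<in> I"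
  shows "indexed_partition I J (\<lambda>k. if k = i then J else {})"
  using assms by (auto simp: indexed_partition_def disjoint_family_on_def)

lemma woven_withI:
  assumes "0 < A" "0 < B"
    and fr: "\<And>\<sigma>. indexed_partition I J \<sigma> \<Longrightarrow> frame_with ip (SIGMA i:I. \<sigma> i) (\<lambda>(i, j). F i j) A B"
  shows "woven_with ip I J F A B"
proof -
  have "is_frame ip J (F i)" if "i \<in> I" for i
  proof -
    have "(SIGMA k:I. if k = i then J else {}) = Pair i ` J"
      using that by (auto split: if_splits)
    then have "frame_with ip (Pair i ` J) (\<lambda>(i, j). F i j) A B"
      using fr[OF indexed_partition_single[OF that]] by simp
    then have "frame_with ip J ((\<lambda>(i, j). F i j) \<circ> Pair i) A B"
      by (subst (asm) frame_with_reindex) (auto intro: inj_onI)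
    then show ?thesis
      by (auto simp: is_frame_def o_def)
  qed
  then show ?thesis
    using assms by (auto simp: woven_with_def)
qed

theorem theorem2p14:
  fixes scale :: "'k::rc_field \<Rightarrow> 'h::banach \<Rightarrow> 'h"
    and ip :: "'h \<Rightarrow> 'h \<Rightarrow> 'k"
    and J :: "'j set"
    and m :: nat
    and F F' :: "nat \<Rightarrow> 'j \<Rightarrow> 'h"
    and lam :: "nat \<Rightarrow> real"
    and A B :: real
  assumes "hilbert_space scale ip"
    and "separable_space (euclidean :: 'h topology)"
    and "countable J"
    and "1 \<le> m"
    and "woven_with ip {1..m} J F A B"
    and "\<And>i. i \<in> {1..m} \<Longrightarrow> perturbation J (lam i) (F i) (F' i)"
    and "\<And>i. i \<in> {1..m} \<Longrightarrow> lam i < A / (2 * sqrt (real m * B))"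
  shows "woven ip {1..m} J F'"
proof -
  interpret hilbert_space scale ip
    by fact
  let ?I = "{1..m}"
  have "0 < A" "0 < B"
    and fr: "\<And>\<sigma>. indexed_partition ?I J \<sigma>
      \<Longrightarrow> frame_with ip (SIGMA i:?I. \<sigma> i) (\<lambda>(i, j). F i j) A B"
    using assms(5) by (auto simp: woven_with_def)
  show ?thesis
  proof (cases "\<forall>f::'h. f = 0")
    \<comment> \<open>In the zero space there is no vector from which to derive
      \<open>A \<le> B\<close>, but all coefficients vanish and any positive bounds work.\<close>
    case True
    then have "ip f x = 0" for f x
      by (metis ip_zero_left)
    moreover have "norm f = 0" for f :: 'h
      using True by simp
    ultimately have "woven_with ip ?I J F' 1 1"
      by (intro woven_withI) (simp_all add: frame_with_def)
    then show ?thesis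
      by (auto simp: woven_def)
  next
    case False
    then obtain f :: 'h where "f \<noteq> 0"
      by blast
    have "1 \<in> ?I"
      using \<open>1 \<le> m\<close> by simp
    from fr[OF indexed_partition_single[OF this]] have "A * (norm f)\<^sup>2 \<le> B * (norm f)\<^sup>2"
      unfolding frame_with_def by (meson order_trans)
    then have "A \<le> B"
      using \<open>f \<noteq> 0\<close> by simp
    \<comment> \<open>\<open>C\<close> adds the Bessel constants of the \<open>m\<close> blocks. The
      hypothesis on \<open>lam i\<close> makes each smaller than \<open>A^2 / (m * B)\<close>, so
      the total stays below \<open>A^2 / B\<close>.\<close>
    define C where "C = (\<Sum>i\<in>?I. 4 * (lam i)\<^sup>2)"
    have "C < (\<Sum>i\<in>?I. A\<^sup>2 / (real m * B))"
      unfolding C_def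
    proof (rule sum_strict_mono)
      fix i assume i: "i \<in> ?I"
      have "0 < lam i"
        using assms(6)[OF i] by (simp add: perturbation_def)
      then have "(lam i)\<^sup>2 < (A / (2 * sqrt (real m * B)))\<^sup>2"
        using assms(7)[OF i] by (intro power_strict_mono) auto
      also have "\<dots> = A\<^sup>2 / (4 * (real m * B))"
        using \<open>0 < B\<close> by (simp add: power_divide power_mult_distrib)
      finally show "4 * (lam i)\<^sup>2 < A\<^sup>2 / (real m * B)"
        by (simp add: divide_divide_eq_left[symmetric] mult.commute[of 4] del: divide_divide_eq_left)
    qed (use \<open>1 \<le> m\<close> in auto)
    also have "\<dots> = A\<^sup>2 / B"
      using \<open>1 \<le> m\<close> by simp
    also have "\<dots> \<le> A"
      using \<open>A \<le> B\<close> \<open>0 < A\<close> \<open>0 < B\<close> by (simp add: power2_eq_square divide_le_eq mult_left_mono)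
    finally have "C < A" .
    have "0 \<le> C"
      by (simp add: C_def sum_nonneg)
    have "woven_with ip ?I J F' ((sqrt A - sqrt C)\<^sup>2) ((sqrt B + sqrt C)\<^sup>2)"
    proof (rule woven_withI)
      show "0 < (sqrt A - sqrt C)\<^sup>2"
        using \<open>C < A\<close> by simp
      show "0 < (sqrt B + sqrt C)\<^sup>2"
        using \<open>0 < B\<close> \<open>0 \<le> C\<close> by (intro zero_less_power add_pos_nonneg) simp_all
      fix \<sigma> assume part: "indexed_partition ?I J \<sigma>"
      show "frame_with ip (SIGMA i:?I. \<sigma> i) (\<lambda>(i, j). F' i j)
          ((sqrt A - sqrt C)\<^sup>2) ((sqrt B + sqrt C)\<^sup>2)"
      proof (rule frame_with_perturb[OF fr[OF part] \<open>0 \<le> C\<close> \<open>C < A\<close>])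
        fix f T assume T: "finite T" "T \<subseteq> (SIGMA i:?I. \<sigma> i)"
        \<comment> \<open>The slices of \<open>T\<close> are finite subsets of \<open>J\<close>, so
          the Bessel estimate applies to each with its own \<open>lam i\<close>.\<close>
        define S where "S i = {j. (i, j) \<in> T}" for i
        have S: "finite (S i)" "S i \<subseteq> J" if "i \<in> ?I" for i
        proof -
          have "S i \<subseteq> snd ` T"
            by (force simp: S_def)
          then show "finite (S i)"
            using T(1) finite_subset by blast
          show "S i \<subseteq> J"
            using T(2) part that by (auto simp: S_def indexed_partition_def)
        qed
        have "T = (SIGMA i:?I. S i)"
          using T(2) by (auto simp: S_def)
        then have "(\<Sum>k\<in>T. (norm (ip f ((case k of (i, j) \<Rightarrow> F i j) - (case k of (i, j) \<Rightarrow> F' i j))))\<^sup>2)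
            = (\<Sum>i\<in>?I. \<Sum>j\<in>S i. (norm (ip f (F i j - F' i j)))\<^sup>2)"
          using S(1) by (subst sum.Sigma) (auto simp: case_prod_unfold)
        also have "\<dots> \<le> (\<Sum>i\<in>?I. 4 * (lam i)\<^sup>2 * (norm f)\<^sup>2)"
        proof (intro sum_mono sum_ip_le)
          fix i assume i: "i \<in> ?I"
          show "finite (S i)"
            using S(1)[OF i] .
          show "norm (\<Sum>j\<in>S i. a j *\<^sub>R (F i j - F' i j)) \<le> lam i * sqrt (\<Sum>j\<in>S i. (a j)\<^sup>2)"
            if "\<And>j. 0 \<le> a j" for a
            using assms(6)[OF i] \<open>countable J\<close> S[OF i] that by (rule perturbation_finite)
        qed
        also have "\<dots> = C * (norm f)\<^sup>2"
          by (simp add: C_def sum_distrib_right)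
        finally show "(\<Sum>k\<in>T. (norm (ip f ((case k of (i, j) \<Rightarrow> F i j)
            - (case k of (i, j) \<Rightarrow> F' i j))))\<^sup>2) \<le> C * (norm f)\<^sup>2" .
      qed
    qed
    then show ?thesis
      by (auto simp: woven_def)
  qed
qed

end
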